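(* For every integer $n\ge 0$, the Gaussian Mersenne Lucas numbers satisfy $$Gm_n = 2^n+1+i\left(2^{n-1}+1\right).$$
   Context: Here $i$ is the imaginary unit. The Gaussian Mersenne Lucas numbers $\{Gm_n\}_{n\ge 0}$ are the complex numbers defined by $Gm_0 = 2+\frac{3i}{2}$, $Gm_1 = 3+2i$, and $Gm_n = 3Gm_{n-1}-2Gm_{n-2}$ for $n\ge 2$. *)

theory Defs
  imports Complex_Main
begin

fun Gm :: "nat \<Rightarrow> complex" where
  "Gm 0 = 2 + 3 * \<i> / 2"
| "Gm (Suc 0) = 3 + 2 * \<i>"
| "Gm (Suc (Suc n)) = 3 * Gm (Suc n) - 2 * Gm n"

end

theory Submission
  imports Defs
begin

text \<open>The characteristic polynomial \<open>x\<^sup>2 - 3 * x + 2\<close> of the recurrence has the roots \<open>1\<close> and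
  \<open>2\<close>, so every solution is a combination of \<open>1\<close> and \<open>2 ^ n\<close>. The closed form is the one with
  coefficients \<open>1 + \<i>\<close> and \<open>1 + \<i> / 2\<close>, which the two initial values determine. It remains to
  write \<open>2 powi (int n - 1)\<close>, whose exponent is negative at \<open>n = 0\<close>, as \<open>2 ^ n / 2\<close>.\<close>

lemma Gm_eq_combination: "Gm n = (1 + \<i>) + (1 + \<i> / 2) * 2 ^ n"
  by (induction n rule: Gm.induct) (simp_all add: algebra_simps)

theorem theorem1:
  fixes n :: nat
  shows "Gm n = 2 ^ n + 1 + \<i> * (2 powi (int n - 1) + 1)"
proof -
  have "(2::complex) powi (int n - 1) = 2 ^ n / 2"
    by (simp add: power_int_diff)
  then show ?thesis
    by (simp add: Gm_eq_combination algebra_simps)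
qed

end
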